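(* Let $p$ be a fixed prime. Then the sequence of graphs $\langle \tilde{\Gamma}(H_{2k+1}(p)) : k \rightarrow \infty \rangle$ is quasirandom.
   Context: Heisenberg group: for a prime $p$ and $k \geq 1$, $H_{2k+1}(p) = \{[x,y,z] : x,y \in \mathbb{F}_p^k,\ z \in \mathbb{F}_p\}$ with product $[x,y,z][x',y',z'] = [x+x', y+y', z+z'+x\cdot y']$, where $x\cdot y' = x_1y'_1+\cdots+x_ky'_k$. Elements $[x,y,z]$ and $[a,b,c]$ commute if and only if $x\cdot b - a\cdot y = 0$ in $\mathbb{F}_p$. The center is $\{[0,0,z]\}$, and the non-central conjugacy classes are the sets $C_{x,y} = \{[x,y,z] : z\in\mathbb{F}_p\}$ with $(x,y)\neq(0,0)$. The graph $\tilde{\Gamma}(H_{2k+1}(p))$: its vertices are the pairs $(x,y)\in \mathbb{F}_p^{k}\times\mathbb{F}_p^{k}$ (representing the classes $C_{x,y}$; the pair $(0,0)$ representing the center is included as one vertex), so it has $n = p^{2k}$ vertices; $(x,y)$ and $(a,b)$ are adjacent if and only if $x\cdot b - a\cdot y = 0$ in $\mathbb{F}_p$ (so there is a loop at every vertex). Quasirandomness: for a graph $G$ (loops allowed) on $n$ vertices, $N(v)$ denotes the neighborhood of $v$, and the density $\delta$ is the number of ordered pairs $(v,w)$ of adjacent vertices divided by $n^2$. A sequence of graphs $G$ with number of vertices $n\to\infty$ is quasirandom if $\sum_{v,w\in V(G)} \big|\,|N(v)\cap N(w)| - \delta^2 n\,\big| = o(n^3)$ (the sum being over ordered pairs of vertices).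 *)

theory Defs
  imports "HOL-Algebra.Group" "HOL-Number_Theory.Cong" "HOL-Library.FuncSet"
    "HOL-Library.Landau_Symbols"
begin

text \<open>
  Undirected graphs in which loops are allowed. The edges are given as a symmetric relation, so
  an edge between distinct vertices contributes two ordered pairs and a loop contributes one.
\<close>

record 'a loop_graph =
  verts :: "'a set"
  adj :: "('a \<times> 'a) set"

definition finite_loop_graph :: "'a loop_graph \<Rightarrow> bool" where
  "finite_loop_graph G \<longleftrightarrow>
     finite (verts G) \<and> adj G \<subseteq> verts G \<times> verts G \<and> sym (adj G)"

definition num_verts :: "'a loop_graph \<Rightarrow> nat" where
  "num_verts G = card (verts G)"

definition nbhd :: "'a loop_graph \<Rightarrow> 'a \<Rightarrow> 'a set" where
  "nbhd G v = {w \<in> verts G. (v, w) \<in> adj G}"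

definition edge_density :: "'a loop_graph \<Rightarrow> real" where
  "edge_density G =
     real (card {(v, w). v \<in> verts G \<and> w \<in> verts G \<and> (v, w) \<in> adj G}) / real (num_verts G) ^ 2"

definition quasirandom :: "(nat \<Rightarrow> 'a loop_graph) \<Rightarrow> bool" where
  "quasirandom G \<longleftrightarrow>
     (\<forall>k. finite_loop_graph (G k)) \<and>
     filterlim (\<lambda>k. num_verts (G k)) at_top sequentially \<and>
     (\<lambda>k. \<Sum>v\<in>verts (G k). \<Sum>w\<in>verts (G k).
        \<bar>real (card (nbhd (G k) v \<inter> nbhd (G k) w)) - edge_density (G k) ^ 2 * real (num_verts (G k))\<bar>)
       \<in> o[sequentially](\<lambda>k. real (num_verts (G k)) ^ 3)"

text \<open>
  The field with \<open>p\<close> elements is represented by the residues \<open>0, \<dots>, p - 1\<close>, with arithmetic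
  modulo \<open>p\<close>. Vectors of length \<open>k\<close> are extensional functions on \<open>{..<k}\<close>, so that each vector
  has exactly one representation.
\<close>

definition Fp_vec :: "nat \<Rightarrow> nat \<Rightarrow> (nat \<Rightarrow> int) set" where
  "Fp_vec p k = {..<k} \<rightarrow>\<^sub>E {0..<int p}"

definition vec_add :: "nat \<Rightarrow> nat \<Rightarrow> (nat \<Rightarrow> int) \<Rightarrow> (nat \<Rightarrow> int) \<Rightarrow> nat \<Rightarrow> int" where
  "vec_add p k x y = (\<lambda>i\<in>{..<k}. (x i + y i) mod int p)"

text \<open>The dot product as an integer; only its residue modulo \<open>p\<close> is meaningful.\<close>

definition dot :: "nat \<Rightarrow> (nat \<Rightarrow> int) \<Rightarrow> (nat \<Rightarrow> int) \<Rightarrow> int" where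
  "dot k x y = (\<Sum>i<k. x i * y i)"

text \<open>The Heisenberg group of order \<open>p\<close> to the power \<open>2 * k + 1\<close>.\<close>

definition heisenberg :: "nat \<Rightarrow> nat \<Rightarrow> ((nat \<Rightarrow> int) \<times> (nat \<Rightarrow> int) \<times> int) monoid" where
  "heisenberg p k =
     \<lparr>carrier = Fp_vec p k \<times> Fp_vec p k \<times> {0..<int p},
      monoid.mult = (\<lambda>(x, y, z) (x', y', z').
        (vec_add p k x x', vec_add p k y y', (z + z' + dot k x y') mod int p)),
      one = (\<lambda>i\<in>{..<k}. 0, \<lambda>i\<in>{..<k}. 0, 0)\<rparr>"

text \<open>
  The vertex \<open>(x, y)\<close> stands for the conjugacy class of the elements \<open>(x, y, z)\<close> of the
  Heisenberg group if \<open>(x, y)\<close> is nonzero, and for the whole centre if it is zero.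
\<close>

definition heisenberg_graph :: "nat \<Rightarrow> nat \<Rightarrow> ((nat \<Rightarrow> int) \<times> (nat \<Rightarrow> int)) loop_graph" where
  "heisenberg_graph p k =
     \<lparr>verts = Fp_vec p k \<times> Fp_vec p k,
      adj = {((x, y), (a, b)).
        (x, y) \<in> Fp_vec p k \<times> Fp_vec p k \<and> (a, b) \<in> Fp_vec p k \<times> Fp_vec p k \<and>
        [dot k x b - dot k a y = 0] (mod int p)}\<rparr>"

lemma vec_add_commute: "vec_add p k x y = vec_add p k y x"
  by (simp add: vec_add_def add.commute)

lemma dot_commute: "dot k x y = dot k y x"
  by (simp add: dot_def mult.commute)

lemma heisenberg_group:
  assumes "p > 0"
  shows "group (heisenberg p k)"
proof -
  have vec: "vec_add p k x y \<in> Fp_vec p k" for x y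
    using assms by (auto simp: vec_add_def Fp_vec_def)
  have dot_l: "[dot k (vec_add p k x y) z = dot k x z + dot k y z] (mod int p)" for x y z
    unfolding dot_def vec_add_def sum.distrib[symmetric]
    by (rule cong_sum) (simp add: cong_def mod_mult_left_eq flip: distrib_right)
  have dot_r: "[dot k z (vec_add p k x y) = dot k z x + dot k z y] (mod int p)" for x y z
    using dot_l[of x y z] by (simp add: dot_commute[of k z])
  show ?thesis
  proof (rule groupI)
    fix u v w
    assume "u \<in> carrier (heisenberg p k)" "v \<in> carrier (heisenberg p k)"
      "w \<in> carrier (heisenberg p k)"
    obtain x y z x' y' z' x'' y'' z''
      where [simp]: "u = (x, y, z)" "v = (x', y', z')" "w = (x'', y'', z'')"
      by (cases u, cases v, cases w) blast
    have "[(z + z' + dot k x y') mod int p + z'' + dot k (vec_add p k x x') y''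
         = (z + z' + dot k x y') + z'' + (dot k x y'' + dot k x' y'')] (mod int p)"
      by (intro cong_add dot_l cong_refl) (simp add: cong_def)
    moreover have "[z + (z' + z'' + dot k x' y'') mod int p + dot k x (vec_add p k y' y'')
         = z + (z' + z'' + dot k x' y'') + (dot k x y' + dot k x y'')] (mod int p)"
      by (intro cong_add dot_r cong_refl) (simp add: cong_def)
    ultimately show "u \<otimes>\<^bsub>heisenberg p k\<^esub> v \<otimes>\<^bsub>heisenberg p k\<^esub> w
      = u \<otimes>\<^bsub>heisenberg p k\<^esub> (v \<otimes>\<^bsub>heisenberg p k\<^esub> w)"
      by (simp add: heisenberg_def vec_add_def cong_def mod_simps algebra_simps cong: restrict_cong)
  next
    fix u assume u: "u \<in> carrier (heisenberg p k)"
    obtain x y z where [simp]: "u = (x, y, z)" by (cases u) blast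
    have "vec_add p k (\<lambda>i\<in>{..<k}. 0) x = x" if "x \<in> Fp_vec p k" for x
      using that unfolding vec_add_def Fp_vec_def
      by (intro ext) (auto simp: PiE_def Pi_def extensional_def)
    with u show "\<one>\<^bsub>heisenberg p k\<^esub> \<otimes>\<^bsub>heisenberg p k\<^esub> u = u"
      by (simp add: heisenberg_def dot_def)
    define m where "m x = (\<lambda>i\<in>{..<k}. (- x i) mod int p)" for x :: "nat \<Rightarrow> int"
    have "m x \<in> Fp_vec p k" for x
      using assms by (auto simp: m_def Fp_vec_def)
    moreover have "vec_add p k (m x) x = (\<lambda>i\<in>{..<k}. 0)" for x
      by (simp add: m_def vec_add_def mod_simps cong: restrict_cong)
    moreover have "((- a - b) mod n + a + b) mod n = 0" for a b n :: int
      using mod_add_left_eq[of "- a - b" n "a + b"] by (simp add: add.assoc)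
    ultimately show "\<exists>v\<in>carrier (heisenberg p k). v \<otimes>\<^bsub>heisenberg p k\<^esub> u = \<one>\<^bsub>heisenberg p k\<^esub>"
      using assms
      by (intro bexI[of _ "(m x, m y, (- z - dot k (m x) y) mod int p)"])
        (simp_all add: heisenberg_def)
  qed (use assms vec in \<open>auto simp: heisenberg_def Fp_vec_def\<close>)
qed

lemma heisenberg_commute_iff_adj:
  assumes "(x, y, z) \<in> carrier (heisenberg p k)" "(a, b, c) \<in> carrier (heisenberg p k)"
  shows "(x, y, z) \<otimes>\<^bsub>heisenberg p k\<^esub> (a, b, c) = (a, b, c) \<otimes>\<^bsub>heisenberg p k\<^esub> (x, y, z)
    \<longleftrightarrow> ((x, y), (a, b)) \<in> adj (heisenberg_graph p k)"
  using assms
  by (auto simp: heisenberg_def heisenberg_graph_def vec_add_commute cong_iff_dvd_diff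
      mod_eq_dvd_iff algebra_simps)

end

theory Submission
  imports "HOL-Real_Asymp.Real_Asymp" Defs
begin

text \<open>
  Write \<open>n\<close> for the number of vertices. Adjacency is orthogonality with respect to a symplectic
  form over the field with \<open>p\<close> elements, and two facts about this form suffice.

  \<^item> The neighbourhood of a nonzero vertex is the kernel of a nonzero functional, so its degree is
    \<open>n / p\<close>; the zero vertex has degree \<open>n\<close> (\<open>degree_nonzero\<close>, \<open>nbhd_zero_vertex\<close>).
  \<^item> A common neighbourhood is the kernel of a linear map into a space with \<open>p\<^sup>2\<close> elements, so it
    always has at least \<open>n / p\<^sup>2\<close> elements (\<open>codegree_lower\<close>).

  The degrees determine the sum of all codegrees, because counting paths of length two by their
  middle vertex gives the sum of the squared degrees. This sum exceeds \<open>n\<^sup>2 * (n / p\<^sup>2)\<close> by less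
  than \<open>n\<^sup>2\<close>. Since no codegree is below \<open>n / p\<^sup>2\<close>, there is no cancellation, and the sum of the
  absolute deviations from \<open>n / p\<^sup>2\<close> is also less than \<open>n\<^sup>2\<close>. It is therefore never necessary to
  decide which pairs of vertices are linearly independent. Finally \<open>\<delta>\<^sup>2 * n\<close> differs from
  \<open>n / p\<^sup>2\<close> by at most \<open>2\<close>, so the sum in the definition of quasirandomness is at most
  \<open>3 * n\<^sup>2\<close> (\<open>codegree_deviation_le\<close>).
\<close>

section \<open>Degrees and codegrees in graphs with loops\<close>

lemma nbhd_sym:
  assumes "finite_loop_graph G"
  shows "v \<in> verts G \<and> u \<in> nbhd G v \<longleftrightarrow> u \<in> verts G \<and> v \<in> nbhd G u"
  using assms by (auto simp: finite_loop_graph_def nbhd_def dest: symD)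

text \<open>Both sides count the paths of length two; on the right they are grouped by middle vertex.\<close>

lemma sum_codegrees:
  assumes "finite_loop_graph G"
  shows "(\<Sum>v\<in>verts G. \<Sum>w\<in>verts G. card (nbhd G v \<inter> nbhd G w)) = (\<Sum>u\<in>verts G. card (nbhd G u) ^ 2)"
proof -
  let ?V = "verts G"
  have fin: "finite ?V"
    using assms by (simp add: finite_loop_graph_def)
  have "(\<Sum>v\<in>?V. \<Sum>w\<in>?V. card (nbhd G v \<inter> nbhd G w))
      = (\<Sum>v\<in>?V. \<Sum>w\<in>?V. \<Sum>u\<in>?V. of_bool (u \<in> nbhd G v) * of_bool (u \<in> nbhd G w))"
  proof (intro sum.cong refl)
    fix v w
    have "?V \<inter> {u. u \<in> nbhd G v \<and> u \<in> nbhd G w} = nbhd G v \<inter> nbhd G w"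
      by (auto simp: nbhd_def)
    then show "card (nbhd G v \<inter> nbhd G w)
        = (\<Sum>u\<in>?V. of_bool (u \<in> nbhd G v) * of_bool (u \<in> nbhd G w))"
      using fin by (simp add: sum_of_bool_eq flip: of_bool_conj)
  qed
  also have "\<dots> = (\<Sum>v\<in>?V. \<Sum>u\<in>?V. \<Sum>w\<in>?V. of_bool (u \<in> nbhd G v) * of_bool (u \<in> nbhd G w))"
    by (intro sum.cong refl sum.swap)
  also have "\<dots> = (\<Sum>u\<in>?V. \<Sum>v\<in>?V. \<Sum>w\<in>?V. of_bool (u \<in> nbhd G v) * of_bool (u \<in> nbhd G w))"
    by (rule sum.swap)
  also have "\<dots> = (\<Sum>u\<in>?V. (\<Sum>v\<in>?V. of_bool (u \<in> nbhd G v)) ^ 2)"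
    by (simp add: power2_eq_square sum_product)
  also have "\<dots> = (\<Sum>u\<in>?V. card (nbhd G u) ^ 2)"
  proof (intro sum.cong refl)
    fix u assume u: "u \<in> ?V"
    have "(\<Sum>v\<in>?V. of_bool (u \<in> nbhd G v)) = card {v \<in> ?V. u \<in> nbhd G v}"
      using fin by (simp add: sum_of_bool_eq Int_def)
    also have "{v \<in> ?V. u \<in> nbhd G v} = nbhd G u"
      using u nbhd_sym[OF assms] by (auto simp: nbhd_def)
    finally show "(\<Sum>v\<in>?V. of_bool (u \<in> nbhd G v)) ^ 2 = card (nbhd G u) ^ 2"
      by simp
  qed
  finally show ?thesis .
qed

lemma edge_density_eq_sum_degrees:
  assumes "finite_loop_graph G"
  shows "edge_density G = (\<Sum>v\<in>verts G. real (card (nbhd G v))) / real (num_verts G) ^ 2"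
proof -
  have "{(v, w). v \<in> verts G \<and> w \<in> verts G \<and> (v, w) \<in> adj G} = Sigma (verts G) (nbhd G)"
    by (auto simp: nbhd_def)
  moreover have "card (Sigma (verts G) (nbhd G)) = (\<Sum>v\<in>verts G. card (nbhd G v))"
    using assms by (intro card_SigmaI) (auto simp: finite_loop_graph_def nbhd_def)
  ultimately show ?thesis
    by (simp add: edge_density_def)
qed

text \<open>
  A lower bound for every codegree that nearly matches the average codegree turns the sum of
  absolute deviations into a difference of two explicit sums.
\<close>

lemma codegree_deviation_le:
  fixes q :: real
  assumes G: "finite_loop_graph G" and q: "q \<ge> 1" and z: "z \<in> verts G"
    and deg_z: "card (nbhd G z) = num_verts G"
    and deg: "\<And>v. v \<in> verts G \<Longrightarrow> v \<noteq> z \<Longrightarrow> real (card (nbhd G v)) = num_verts G / q"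
    and codeg: "\<And>v w. v \<in> verts G \<Longrightarrow> w \<in> verts G \<Longrightarrow>
      real (card (nbhd G v \<inter> nbhd G w)) \<ge> num_verts G / q ^ 2"
  shows "(\<Sum>v\<in>verts G. \<Sum>w\<in>verts G. \<bar>real (card (nbhd G v \<inter> nbhd G w))
      - edge_density G ^ 2 * real (num_verts G)\<bar>) \<le> 3 * real (num_verts G) ^ 2"
proof -
  let ?V = "verts G" and ?c = "\<lambda>v w. real (card (nbhd G v \<inter> nbhd G w))"
  define n where "n = real (num_verts G)"
  define d where "d = edge_density G"
  have fin: "finite ?V"
    using G by (simp add: finite_loop_graph_def)
  have card_V: "real (card ?V) = n"
    by (simp add: n_def num_verts_def)
  have "card ?V > 0"
    using fin z by (auto simp: card_gt_0_iff)
  then have n: "n \<ge> 1"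
    using card_V by linarith
  have card_rest: "real (card (?V - {z})) = n - 1"
    using fin z n card_V by (simp add: card_Diff_singleton of_nat_diff)
  have sum_deg: "(\<Sum>v\<in>?V. f (real (card (nbhd G v)))) = f n + (n - 1) * f (n / q)"
    for f :: "real \<Rightarrow> real"
    using fin z deg deg_z card_rest by (simp add: sum.remove[of _ z] flip: n_def)

  have d_eq: "d = 1 / q + (1 - 1 / q) / n"
    using n q sum_deg[of "\<lambda>x. x"]
    by (simp add: d_def edge_density_eq_sum_degrees[OF G] power2_eq_square field_simps flip: n_def)
  have "(1 - 1 / q) / n \<le> 1 - 1 / q"
    using n q by (simp add: divide_le_eq mult_le_cancel_left1)
  then have d_le: "d \<le> 1" "1 / q \<le> 1" "0 \<le> d" "0 \<le> 1 / q"
    using n q by (auto simp: d_eq)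
  have "d ^ 2 * n - n / q ^ 2 = (1 - 1 / q) * (d + 1 / q)"
    using n q by (simp add: d_eq power2_eq_square field_simps)
  moreover have "0 \<le> (1 - 1 / q) * (d + 1 / q)" "(1 - 1 / q) * (d + 1 / q) \<le> 1 * 2"
    using d_le by (intro mult_nonneg_nonneg mult_mono; simp)+
  ultimately have centre: "\<bar>n / q ^ 2 - d ^ 2 * n\<bar> \<le> 2"
    by simp

  have "(\<Sum>v\<in>?V. \<Sum>w\<in>?V. ?c v w) = real (\<Sum>v\<in>?V. card (nbhd G v) ^ 2)"
    by (simp flip: sum_codegrees[OF G])
  also have "\<dots> = n ^ 2 + (n - 1) * (n / q) ^ 2"
    using sum_deg[of "\<lambda>x. x ^ 2"] by simp
  finally have sum_c: "(\<Sum>v\<in>?V. \<Sum>w\<in>?V. ?c v w) = n ^ 2 + (n - 1) * (n / q) ^ 2" .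

  have "(\<Sum>v\<in>?V. \<Sum>w\<in>?V. \<bar>?c v w - d ^ 2 * n\<bar>) \<le> (\<Sum>v\<in>?V. \<Sum>w\<in>?V. ?c v w - n / q ^ 2 + 2)"
  proof (intro sum_mono)
    fix v w assume "v \<in> ?V" "w \<in> ?V"
    then have "?c v w \<ge> n / q ^ 2"
      using codeg by (simp add: n_def)
    then show "\<bar>?c v w - d ^ 2 * n\<bar> \<le> ?c v w - n / q ^ 2 + 2"
      using centre by linarith
  qed
  also have "\<dots> = n ^ 2 + (n - 1) * (n / q) ^ 2 - n * (n * (n / q ^ 2)) + n * (n * 2)"
    by (simp add: sum.distrib sum_subtractf sum_c card_V)
  also have "\<dots> = 3 * n ^ 2 - (n / q) ^ 2"
    using q by (simp add: power2_eq_square field_simps)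
  also have "\<dots> \<le> 3 * n ^ 2"
    by simp
  finally show ?thesis
    by (simp add: n_def d_def)
qed

section \<open>The symplectic form\<close>

definition symp_form :: "nat \<Rightarrow> (nat \<Rightarrow> int) \<times> (nat \<Rightarrow> int) \<Rightarrow> (nat \<Rightarrow> int) \<times> (nat \<Rightarrow> int) \<Rightarrow> int" where
  "symp_form k v w = dot k (fst v) (snd w) - dot k (fst w) (snd v)"

definition vec_shift :: "nat \<Rightarrow> nat \<Rightarrow> int \<Rightarrow> (nat \<Rightarrow> int) \<Rightarrow> (nat \<Rightarrow> int) \<Rightarrow> nat \<Rightarrow> int" where
  "vec_shift p k t x y = (\<lambda>i\<in>{..<k}. (y i + t * x i) mod int p)"

definition shift ::
  "nat \<Rightarrow> nat \<Rightarrow> int \<Rightarrow> (nat \<Rightarrow> int) \<times> (nat \<Rightarrow> int) \<Rightarrow> (nat \<Rightarrow> int) \<times> (nat \<Rightarrow> int)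
    \<Rightarrow> (nat \<Rightarrow> int) \<times> (nat \<Rightarrow> int)" where
  "shift p k t u w = (vec_shift p k t (fst u) (fst w), vec_shift p k t (snd u) (snd w))"

abbreviation vertices :: "nat \<Rightarrow> nat \<Rightarrow> ((nat \<Rightarrow> int) \<times> (nat \<Rightarrow> int)) set" where
  "vertices p k \<equiv> Fp_vec p k \<times> Fp_vec p k"

lemma finite_Fp_vec: "finite (Fp_vec p k)"
  by (simp add: Fp_vec_def finite_PiE)

lemma shift_in_vertices: "p > 0 \<Longrightarrow> shift p k t u w \<in> vertices p k"
  by (simp add: shift_def vec_shift_def Fp_vec_def)

lemma vec_shift_inj: "inj_on (vec_shift p k t x) (Fp_vec p k)"
proof (rule inj_onI)
  fix y z assume y: "y \<in> Fp_vec p k" and z: "z \<in> Fp_vec p k"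
    and eq: "vec_shift p k t x y = vec_shift p k t x z"
  show "y = z"
  proof (rule PiE_ext)
    show "y \<in> {..<k} \<rightarrow>\<^sub>E {0..<int p}" "z \<in> {..<k} \<rightarrow>\<^sub>E {0..<int p}"
      using y z by (simp_all add: Fp_vec_def)
    fix i assume i: "i \<in> {..<k}"
    have "(y i + t * x i) mod int p = (z i + t * x i) mod int p"
      using fun_cong[OF eq, of i] i unfolding vec_shift_def by simp
    then have "[y i = z i] (mod int p)"
      unfolding cong_def[symmetric] by (simp only: cong_add_rcancel)
    moreover have "y i \<in> {0..<int p}" "z i \<in> {0..<int p}"
      using y z i unfolding Fp_vec_def by (blast intro: PiE_mem)+
    ultimately show "y i = z i"
      by (intro cong_less_imp_eq_int[of "y i" "int p" "z i"]) simp_all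
  qed
qed

lemma shift_inj: "inj_on (shift p k t u) (vertices p k)"
proof (rule inj_onI)
  fix v w assume v: "v \<in> vertices p k" and w: "w \<in> vertices p k"
    and "shift p k t u v = shift p k t u w"
  then have "vec_shift p k t (fst u) (fst v) = vec_shift p k t (fst u) (fst w)"
    "vec_shift p k t (snd u) (snd v) = vec_shift p k t (snd u) (snd w)"
    by (simp_all add: shift_def)
  then have "fst v = fst w" "snd v = snd w"
    using v w by (simp_all only: inj_on_eq_iff[OF vec_shift_inj] mem_Times_iff)
  then show "v = w"
    by (rule prod_eqI)
qed

lemma dot_vec_shift: "[dot k z (vec_shift p k t x y) = dot k z y + t * dot k z x] (mod int p)"
proof -
  have "dot k z y + t * dot k z x = (\<Sum>i<k. z i * (y i + t * x i))"
    by (simp add: dot_def sum_distrib_left sum.distrib algebra_simps)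
  moreover have "[dot k z (vec_shift p k t x y) = (\<Sum>i<k. z i * (y i + t * x i))] (mod int p)"
    unfolding dot_def
  proof (rule cong_sum)
    fix i assume "i \<in> {..<k}"
    then show "[z i * vec_shift p k t x y i = z i * (y i + t * x i)] (mod int p)"
      unfolding cong_def by (simp add: vec_shift_def mod_mult_right_eq)
  qed
  ultimately show ?thesis
    by simp
qed

lemma symp_form_shift:
  "[symp_form k v (shift p k t u w) = symp_form k v w + t * symp_form k v u] (mod int p)"
proof -
  have eq: "symp_form k v x = dot k (fst v) (snd x) - dot k (snd v) (fst x)" for x
    by (simp add: symp_form_def dot_commute[of k "snd v"])
  have "[symp_form k v (shift p k t u w) = (dot k (fst v) (snd w) + t * dot k (fst v) (snd u))
      - (dot k (snd v) (fst w) + t * dot k (snd v) (fst u))] (mod int p)"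
    unfolding eq shift_def fst_conv snd_conv by (intro cong_diff dot_vec_shift)
  then show ?thesis
    by (simp add: eq algebra_simps)
qed

text \<open>The form is nondegenerate: a unit vector in the dual coordinate detects a nonzero entry.\<close>

lemma symp_form_nondegenerate:
  assumes v: "v \<in> vertices p k" and nz: "v \<noteq> (\<lambda>i\<in>{..<k}. 0, \<lambda>i\<in>{..<k}. 0)" and p: "p > 1"
  obtains u where "u \<in> vertices p k" "\<not> int p dvd symp_form k v u"
proof -
  define e where "e i = (\<lambda>j\<in>{..<k}. if j = i then 1 else 0 :: int)" for i
  have e: "e i \<in> Fp_vec p k" and zero: "(\<lambda>i\<in>{..<k}. 0) \<in> Fp_vec p k" for i
    using p by (auto simp: e_def Fp_vec_def)
  have dot_e: "dot k x (e i) = x i" if "i < k" for x i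
  proof -
    have "dot k x (e i) = (\<Sum>j<k. if j = i then x j else 0)"
      unfolding dot_def by (intro sum.cong) (auto simp: e_def)
    then show ?thesis
      using that by simp
  qed
  have dot_zero: "dot k x (\<lambda>i\<in>{..<k}. 0) = 0" for x
    by (simp add: dot_def)
  have entry: "\<exists>i<k. \<not> int p dvd x i" if x: "x \<in> Fp_vec p k" "x \<noteq> (\<lambda>i\<in>{..<k}. 0)" for x
  proof -
    obtain i where i: "i < k" "x i \<noteq> 0"
      using x by (auto simp: Fp_vec_def PiE_def extensional_def fun_eq_iff restrict_def split: if_splits)
    then have "0 < x i" "x i < int p"
      using x(1) by (auto simp: Fp_vec_def PiE_iff order_le_less)
    then show ?thesis
      using i zdvd_not_zless by blast
  qed
  obtain x y where xy: "v = (x, y)" "x \<in> Fp_vec p k" "y \<in> Fp_vec p k"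
    using v by auto
  consider "x \<noteq> (\<lambda>i\<in>{..<k}. 0)" | "y \<noteq> (\<lambda>i\<in>{..<k}. 0)"
    using nz xy by auto
  then show ?thesis
  proof cases
    case 1
    then obtain i where "i < k" "\<not> int p dvd x i"
      using entry xy by blast
    then show ?thesis
      using that[of "(\<lambda>i\<in>{..<k}. 0, e i)"] e zero
      by (simp add: symp_form_def xy dot_e dot_zero dot_commute[of k "\<lambda>i\<in>{..<k}. 0"])
  next
    case 2
    then obtain i where "i < k" "\<not> int p dvd y i"
      using entry xy by blast
    then show ?thesis
      using that[of "(e i, \<lambda>i\<in>{..<k}. 0)"] e zero
      by (simp add: symp_form_def xy dot_e dot_zero dot_commute[of k "e i"])
  qed
qed

section \<open>Degrees and codegrees in the Heisenberg graph\<close>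

lemma verts_heisenberg_graph: "verts (heisenberg_graph p k) = vertices p k"
  by (simp add: heisenberg_graph_def)

lemma nbhd_heisenberg_graph:
  "v \<in> vertices p k \<Longrightarrow>
    nbhd (heisenberg_graph p k) v = {u \<in> vertices p k. symp_form k v u mod int p = 0}"
  by (auto simp: nbhd_def heisenberg_graph_def symp_form_def cong_def)

lemma num_verts_heisenberg_graph: "num_verts (heisenberg_graph p k) = p ^ (2 * k)"
  by (simp add: num_verts_def verts_heisenberg_graph card_cartesian_product Fp_vec_def card_PiE
      mult_2 power_add)

lemma finite_loop_graph_heisenberg: "finite_loop_graph (heisenberg_graph p k)"
proof -
  have "[dot k a y - dot k x b = 0] (mod int p)" if "[dot k x b - dot k a y = 0] (mod int p)"
    for a b x y
    using that dvd_minus_iff[of "int p" "dot k x b - dot k a y"] by (simp add: cong_0_iff)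
  then show ?thesis
    by (auto simp: finite_loop_graph_def heisenberg_graph_def finite_Fp_vec sym_def)
qed

lemma nbhd_zero_vertex:
  assumes "p > 0"
  shows "nbhd (heisenberg_graph p k) (\<lambda>i\<in>{..<k}. 0, \<lambda>i\<in>{..<k}. 0) = vertices p k"
proof -
  have "(\<lambda>i\<in>{..<k}. 0) \<in> Fp_vec p k"
    using assms by (auto simp: Fp_vec_def)
  then show ?thesis
    by (auto simp: nbhd_heisenberg_graph symp_form_def dot_def)
qed

text \<open>
  Since \<open>p\<close> is prime, a nonzero functional \<open>symp_form k v\<close> takes a value invertible modulo \<open>p\<close>.
  Shifting along multiples of a vector with such a value permutes the level sets transitively, so
  all \<open>p\<close> of them have the same size.
\<close>

lemma degree_nonzero:
  assumes p: "prime p" and v: "v \<in> vertices p k" and nz: "v \<noteq> (\<lambda>i\<in>{..<k}. 0, \<lambda>i\<in>{..<k}. 0)"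
  shows "p * card (nbhd (heisenberg_graph p k) v) = num_verts (heisenberg_graph p k)"
proof -
  define F where "F c = {u \<in> vertices p k. symp_form k v u mod int p = c}" for c
  have p0: "p > 1"
    using p by (rule prime_gt_1_nat)
  have fin: "finite (vertices p k)"
    by (simp add: finite_Fp_vec)
  obtain u where u: "u \<in> vertices p k" "\<not> int p dvd symp_form k v u"
    using symp_form_nondegenerate[OF v nz p0] .
  have "coprime (symp_form k v u) (int p)"
    using p u(2) by (simp add: prime_imp_coprime coprime_commute)
  then obtain s where s: "[symp_form k v u * s = 1] (mod int p)"
    using cong_solve_coprime_int by blast
  have le: "card (F c) \<le> card (F d)" if d: "d \<in> {0..<int p}" for c d
  proof (rule card_inj_on_le)
    \<comment> \<open>The multiple of \<open>u\<close> on which the functional takes the value \<open>d - c\<close>.\<close>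
    let ?t = "(d - c) * s"
    show "inj_on (shift p k ?t u) (F c)"
      using shift_inj by (rule inj_on_subset) (auto simp: F_def)
    show "shift p k ?t u ` F c \<subseteq> F d"
    proof (rule image_subsetI)
      fix w assume "w \<in> F c"
      then have w: "[symp_form k v w = c] (mod int p)"
        by (auto simp: F_def cong_def)
      have "[symp_form k v w + (d - c) * (symp_form k v u * s) = c + (d - c) * 1] (mod int p)"
        by (intro cong_add cong_mult w s cong_refl)
      then have "[symp_form k v w + ?t * symp_form k v u = d] (mod int p)"
        by (simp add: mult_ac)
      then have "[symp_form k v (shift p k ?t u w) = d] (mod int p)"
        using symp_form_shift cong_trans by blast
      then show "shift p k ?t u w \<in> F d"
        using d p0 shift_in_vertices[of p k ?t u w] by (simp add: F_def cong_def)
    qed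
    show "finite (F d)"
      using fin by (simp add: F_def)
  qed
  have "card (vertices p k) = (\<Sum>c\<in>{0..<int p}. card (F c))"
    using sum.group[OF fin, of "{0..<int p}" "\<lambda>u. symp_form k v u mod int p" "\<lambda>_. 1 :: nat"] p0
    by (simp add: F_def image_subset_iff)
  also have "\<dots> = (\<Sum>c\<in>{0..<int p}. card (F 0))"
    using le p0 by (intro sum.cong refl antisym) auto
  finally show ?thesis
    using v by (simp add: nbhd_heisenberg_graph F_def num_verts_def verts_heisenberg_graph)
qed

text \<open>
  The joint level sets of the functionals \<open>symp_form k v\<close> and \<open>symp_form k w\<close> number at most
  \<open>p\<^sup>2\<close>, and none is larger than the common kernel, because subtracting an element of a level set
  embeds that set in the kernel.
\<close>

lemma codegree_lower:
  assumes p: "p > 0" and v: "v \<in> vertices p k" and w: "w \<in> vertices p k"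
  shows "num_verts (heisenberg_graph p k)
    \<le> p ^ 2 * card (nbhd (heisenberg_graph p k) v \<inter> nbhd (heisenberg_graph p k) w)"
proof -
  define g where "g u = (symp_form k v u mod int p, symp_form k w u mod int p)" for u
  define F where "F c = {u \<in> vertices p k. g u = c}" for c
  have fin: "finite (vertices p k)"
    by (simp add: finite_Fp_vec)
  have le: "card (F c) \<le> card (F (0, 0))" for c
  proof (cases "F c = {}")
    case False
    then obtain u where u: "u \<in> F c"
      by blast
    show ?thesis
    proof (rule card_inj_on_le)
      show "inj_on (shift p k (-1) u) (F c)"
        using shift_inj by (rule inj_on_subset) (auto simp: F_def)
      show "shift p k (-1) u ` F c \<subseteq> F (0, 0)"
      proof (rule image_subsetI)
        fix x assume "x \<in> F c"
        then have eq: "g x = g u"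
          using u by (simp add: F_def)
        have "symp_form k y (shift p k (-1) u x) mod int p = 0"
          if "symp_form k y x mod int p = symp_form k y u mod int p" for y
        proof -
          have "symp_form k y (shift p k (-1) u x) mod int p
              = (symp_form k y x - symp_form k y u) mod int p"
            using symp_form_shift[of k y p "-1" u x] by (simp add: cong_def)
          also have "\<dots> = 0"
            using that by (simp only: mod_eq_dvd_iff mod_eq_0_iff_dvd)
          finally show ?thesis .
        qed
        then show "shift p k (-1) u x \<in> F (0, 0)"
          using eq p shift_in_vertices[of p k "-1" u x] by (simp add: F_def g_def)
      qed
      show "finite (F (0, 0))"
        using fin by (simp add: F_def)
    qed
  qed simp
  have "card (vertices p k) = (\<Sum>c\<in>{0..<int p} \<times> {0..<int p}. card (F c))"
    using sum.group[OF fin, of "{0..<int p} \<times> {0..<int p}" g "\<lambda>_. 1 :: nat"] p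
    by (simp add: F_def g_def image_subset_iff)
  also have "\<dots> \<le> (\<Sum>c\<in>{0..<int p} \<times> {0..<int p}. card (F (0, 0)))"
    by (intro sum_mono le)
  also have "\<dots> = p ^ 2 * card (F (0, 0))"
    by (simp add: power2_eq_square)
  also have "F (0, 0) = nbhd (heisenberg_graph p k) v \<inter> nbhd (heisenberg_graph p k) w"
    using v w by (auto simp: nbhd_heisenberg_graph F_def g_def)
  finally show ?thesis
    by (simp add: num_verts_def verts_heisenberg_graph)
qed

section \<open>Quasirandomness\<close>

lemma heisenberg_graph_deviation_le:
  assumes p: "prime p"
  shows "(\<Sum>v\<in>verts (heisenberg_graph p k). \<Sum>w\<in>verts (heisenberg_graph p k).
      \<bar>real (card (nbhd (heisenberg_graph p k) v \<inter> nbhd (heisenberg_graph p k) w))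
        - edge_density (heisenberg_graph p k) ^ 2 * real (num_verts (heisenberg_graph p k))\<bar>)
    \<le> 3 * real (num_verts (heisenberg_graph p k)) ^ 2"
proof (rule codegree_deviation_le[where q = "real p" and z = "(\<lambda>i\<in>{..<k}. 0, \<lambda>i\<in>{..<k}. 0)"])
  let ?G = "heisenberg_graph p k"
  have p0: "p > 0"
    using p by (rule prime_gt_0_nat)
  show "finite_loop_graph ?G"
    by (rule finite_loop_graph_heisenberg)
  show "real p \<ge> 1"
    using p0 by simp
  show "(\<lambda>i\<in>{..<k}. 0, \<lambda>i\<in>{..<k}. 0) \<in> verts ?G"
    using p0 by (auto simp: verts_heisenberg_graph Fp_vec_def)
  show "card (nbhd ?G (\<lambda>i\<in>{..<k}. 0, \<lambda>i\<in>{..<k}. 0)) = num_verts ?G"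
    using p0 by (simp add: nbhd_zero_vertex num_verts_def verts_heisenberg_graph)
  show "real (card (nbhd ?G v)) = num_verts ?G / real p"
    if "v \<in> verts ?G" "v \<noteq> (\<lambda>i\<in>{..<k}. 0, \<lambda>i\<in>{..<k}. 0)" for v
  proof -
    have "p * card (nbhd ?G v) = num_verts ?G"
      using that p by (intro degree_nonzero) (simp_all add: verts_heisenberg_graph)
    then have "real p * real (card (nbhd ?G v)) = real (num_verts ?G)"
      by (metis of_nat_mult)
    then show ?thesis
      using p0 by (simp add: field_simps)
  qed
  show "real (card (nbhd ?G v \<inter> nbhd ?G w)) \<ge> num_verts ?G / real p ^ 2"
    if "v \<in> verts ?G" "w \<in> verts ?G" for v w
  proof -
    have "num_verts ?G \<le> p ^ 2 * card (nbhd ?G v \<inter> nbhd ?G w)"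
      using that p0 by (intro codegree_lower) (simp_all add: verts_heisenberg_graph)
    then have "real (num_verts ?G) \<le> real p ^ 2 * real (card (nbhd ?G v \<inter> nbhd ?G w))"
      by (metis of_nat_le_iff of_nat_mult of_nat_power)
    then show ?thesis
      using p0 by (simp add: divide_le_eq mult.commute)
  qed
qed

theorem theorem3p2:
  fixes p :: nat
  assumes "prime p"
  shows "quasirandom (\<lambda>k. heisenberg_graph p k)"
proof -
  define n where "n k = num_verts (heisenberg_graph p k)" for k
  have "p > 1"
    using assms by (rule prime_gt_1_nat)
  have "k \<le> n k" for k
  proof -
    have "k < p ^ k"
      using \<open>p > 1\<close> by (intro power_gt_expt) simp
    also have "p ^ k \<le> n k"
      using \<open>p > 1\<close> by (simp add: n_def num_verts_heisenberg_graph power_increasing)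
    finally show ?thesis
      by simp
  qed
  then have n: "filterlim n at_top sequentially"
    by (intro filterlim_at_top_mono[OF filterlim_ident]) auto
  let ?D = "\<lambda>k. \<Sum>v\<in>verts (heisenberg_graph p k). \<Sum>w\<in>verts (heisenberg_graph p k).
      \<bar>real (card (nbhd (heisenberg_graph p k) v \<inter> nbhd (heisenberg_graph p k) w))
        - edge_density (heisenberg_graph p k) ^ 2 * real (n k)\<bar>"
  have "?D \<in> O(\<lambda>k. real (n k) ^ 2)"
    using heisenberg_graph_deviation_le[OF assms]
    by (intro bigoI[of _ 3] always_eventually allI) (simp add: n_def sum_nonneg)
  also have "(\<lambda>k. real (n k) ^ 2) \<in> o(\<lambda>k. real (n k) ^ 3)"
  proof -
    have "filterlim (\<lambda>k. real (n k)) at_top sequentially"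
      using n by (rule filterlim_compose[OF filterlim_real_sequentially])
    moreover have "(\<lambda>x. x ^ 2) \<in> o[at_top](\<lambda>x :: real. x ^ 3)"
      by real_asymp
    ultimately show ?thesis
      by (rule landau_o.small.compose[rotated])
  qed
  finally show ?thesis
    using n by (simp add: quasirandom_def finite_loop_graph_heisenberg n_def[abs_def])
qed

end
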